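(* Let $A=(\Sigma,Q,\delta,I)$ be a top-down tree automaton, let $\sqsubseteq^{\mathsf{dw}}$ be its downward simulation preorder with strict part $\sqsubset^{\mathsf{dw}}$, and let $\subseteq^{\mathsf{up}}(\sqsubseteq^{\mathsf{dw}})$ be the upward trace inclusion preorder induced by $\sqsubseteq^{\mathsf{dw}}$. Then $P(\subseteq^{\mathsf{up}}(\sqsubseteq^{\mathsf{dw}}),\sqsubset^{\mathsf{dw}})$ is good for pruning.
   Context: **Trees.** A ranked alphabet $\Sigma$ is a set of symbols with a rank function $\#:\Sigma\to\mathbb N_0$. Nodes are finite sequences of positive integers; $\varepsilon$ is the empty sequence. A tree over $\Sigma$ is a partial map $t$ from nodes to $\Sigma$ with finite nonempty domain such that if $vi\in\mathrm{dom}(t)$ ($i\ge1$) then $v\in\mathrm{dom}(t)$ and $i\le\#(t(v))$ (some children may be missing). A tree is closed if every $v\in\mathrm{dom}(t)$ has exactly $\#(t(v))$ children in $\mathrm{dom}(t)$. **Automata.** A top-down tree automaton (TDTA) is $A=(\Sigma,Q,\delta,I)$ with $Q$ a finite set of states, $I\subseteq Q$ the initial states, a unique final state $\psi\in Q$ which has no outgoing transitions, and $\delta\subseteq Q\times\Sigma\times Q^+$ a set of transitions, each of the form $\langle q,a,\psi\rangle$ with $\#(a)=0$ or $\langle q,a,q_1\dots q_n\rangle$ with $n=\#(a)\ge1$. A run of $A$ on a tree $t$ (a $t$-run) is a map $\pi$ to $Q$ with domain $\mathrm{dom}(t)\cup\{vi: v\in\mathrm{dom}(t),1\le i\le\#(t(v))\}$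 such that for every $v\in\mathrm{dom}(t)$: if $\#(t(v))=0$ then $\langle\pi(v),t(v),\psi\rangle\in\delta$, and if $n=\#(t(v))\ge1$ then $\langle\pi(v),t(v),\pi(v1)\dots\pi(vn)\rangle\in\delta$. A dangling leaf of $\pi$ is a node in $\mathrm{dom}(\pi)\setminus\mathrm{dom}(t)$. The language $L(A)$ is the set of closed trees $t$ having a $t$-run $\pi$ with $\pi(\varepsilon)\in I$. **Downward simulation.** A downward simulation is a relation $D$ on $Q$ such that $q\,D\,r$ implies ($q=\psi\Rightarrow r=\psi$) and for every $\langle q,a,q_1\dots q_n\rangle\in\delta$ there is $\langle r,a,r_1\dots r_n\rangle\in\delta$ with $q_i\,D\,r_i$ for all $1\le i\le n$. $\sqsubseteq^{\mathsf{dw}}$ is the unique maximal downward simulation; it is a preorder. **Upward trace inclusion.** For a relation $S$ on $Q$, $q\subseteq^{\mathsf{up}}(S)\,r$ iff ($q=\psi\Rightarrow r=\psi$), ($q\in I\Rightarrow r\in I$), and for every tree $t$, every $t$-run $\pi_q$ and every dangling leaf $v$ of $\pi_q$ with $\pi_q(v)=q$ there is a $t$-run $\pi_r$ such that (1) $\pi_r(v)=r$; (2) for all prefixes $v'$ of $v$, $\pi_q(v')\in I\Rightarrow\pi_r(v')\in I$; (3) whenever $v'$ is a strict prefix of $v$ and $v'x\in\mathrm{dom}(\pi_q)$ ($x\ge1$ an integer) is not a prefix of $v$, then $\pi_q(v'x)\,S\,\pi_r(v'x)$. **Strict parts and pruning.** The strict part of a preorder $\le$ is ${\le}\setminus{\le}^{-1}$.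 For a preorder $\le_{\mathsf d}$ on $Q$ with strict part $<_{\mathsf d}$, the lifting of $<_{\mathsf d}$ to tuples is: $(r_1,\dots,r_n)\,\hat<_{\mathsf d}\,(r'_1,\dots,r'_n)$ iff $r_i\le_{\mathsf d}r'_i$ for all $i$ and $r_i<_{\mathsf d}r'_i$ for some $i$. $P(R_{\mathsf u},<_{\mathsf d})$ is the set of pairs of transitions $(\langle p,\sigma,r_1\dots r_n\rangle,\langle p',\sigma,r'_1\dots r'_n\rangle)\in\delta\times\delta$ with $p\,R_{\mathsf u}\,p'$ and $(r_1,\dots,r_n)\,\hat<_{\mathsf d}\,(r'_1,\dots,r'_n)$. For a strict partial order $P$ on $\delta$, $\mathrm{Prune}(A,P)=(\Sigma,Q,\delta',I)$ where $\delta'$ is the set of $\tau\in\delta$ for which there is no $\tau'\in\delta$ with $\tau\,P\,\tau'$. $P$ is good for pruning (GFP) iff $L(\mathrm{Prune}(A,P))=L(A)$. *)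

theory Defs
  imports Main "HOL-Library.Sublist"
begin

text \<open>
  A ranked alphabet is a set \<open>\<Sigma>\<close> of symbols (not required to be finite) with a rank function.
  Children are numbered from 1.
\<close>

type_synonym node = "nat list"
type_synonym 'a tree = "node \<rightharpoonup> 'a"

definition is_tree :: "'a set \<Rightarrow> ('a \<Rightarrow> nat) \<Rightarrow> 'a tree \<Rightarrow> bool" where
  "is_tree \<Sigma> rk t \<longleftrightarrow>
     finite (dom t) \<and> dom t \<noteq> {} \<and> dom t \<subseteq> lists {1..} \<and> ran t \<subseteq> \<Sigma> \<and>
     (\<forall>v i. i \<ge> 1 \<longrightarrow> v @ [i] \<in> dom t \<longrightarrow> v \<in> dom t \<and> i \<le> rk (the (t v)))"

definition closed_tree :: "('a \<Rightarrow> nat) \<Rightarrow> 'a tree \<Rightarrow> bool" where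
  "closed_tree rk t \<longleftrightarrow> (\<forall>v \<in> dom t. card {i. v @ [i] \<in> dom t} = rk (the (t v)))"

record ('q, 'a) tdta =
  symbols :: "'a set"
  rank :: "'a \<Rightarrow> nat"
  states :: "'q set"
  transitions :: "('q \<times> 'a \<times> 'q list) set"
  initial :: "'q set"
  final :: 'q

text \<open>
  A transition reading a symbol of rank 0 has the one-element tuple \<open>[\<psi>]\<close> as its right-hand
  side, where \<open>\<psi>\<close> is the final state.
\<close>

definition is_tdta :: "('q, 'a) tdta \<Rightarrow> bool" where
  "is_tdta A \<longleftrightarrow>
     finite (states A) \<and> initial A \<subseteq> states A \<and> final A \<in> states A \<and>
     transitions A \<subseteq> states A \<times> symbols A \<times> lists (states A) \<and>
     (\<forall>(q, a, qs) \<in> transitions A.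
        q \<noteq> final A \<and>
        (if rank A a = 0 then qs = [final A] else length qs = rank A a))"

definition tree_over :: "('q, 'a) tdta \<Rightarrow> 'a tree \<Rightarrow> bool" where
  "tree_over A t \<longleftrightarrow> is_tree (symbols A) (rank A) t"

definition run :: "('q, 'a) tdta \<Rightarrow> 'a tree \<Rightarrow> (node \<rightharpoonup> 'q) \<Rightarrow> bool" where
  "run A t \<pi> \<longleftrightarrow>
     dom \<pi> = dom t \<union> {v @ [i] | v i. v \<in> dom t \<and> 1 \<le> i \<and> i \<le> rank A (the (t v))} \<and>
     ran \<pi> \<subseteq> states A \<and>
     (\<forall>v \<in> dom t. let a = the (t v); n = rank A a in
        (the (\<pi> v), a,
         if n = 0 then [final A] else map (\<lambda>i. the (\<pi> (v @ [i]))) [1..<n + 1])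
        \<in> transitions A)"

definition dangling_leaf :: "'a tree \<Rightarrow> (node \<rightharpoonup> 'q) \<Rightarrow> node \<Rightarrow> bool" where
  "dangling_leaf t \<pi> v \<longleftrightarrow> v \<in> dom \<pi> - dom t"

definition language :: "('q, 'a) tdta \<Rightarrow> 'a tree set" where
  "language A =
     {t. tree_over A t \<and> closed_tree (rank A) t \<and>
         (\<exists>\<pi>. run A t \<pi> \<and> the (\<pi> []) \<in> initial A)}"

definition downward_simulation :: "('q, 'a) tdta \<Rightarrow> 'q rel \<Rightarrow> bool" where
  "downward_simulation A D \<longleftrightarrow>
     D \<subseteq> states A \<times> states A \<and>
     (\<forall>(q, r) \<in> D.
        (q = final A \<longrightarrow> r = final A) \<and>
        (\<forall>a qs. (q, a, qs) \<in> transitions A \<longrightarrow>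
           (\<exists>rs. (r, a, rs) \<in> transitions A \<and> list_all2 (\<lambda>x y. (x, y) \<in> D) qs rs)))"

definition dw_sim :: "('q, 'a) tdta \<Rightarrow> 'q rel" where
  "dw_sim A = \<Union> {D. downward_simulation A D}"

lemma dw_sim_upper: "downward_simulation A D \<Longrightarrow> D \<subseteq> dw_sim A"
  unfolding dw_sim_def by blast

lemma downward_simulation_dw_sim: "downward_simulation A (dw_sim A)"
  unfolding downward_simulation_def[of A "dw_sim A"]
proof (intro conjI ballI)
  show "dw_sim A \<subseteq> states A \<times> states A"
    unfolding dw_sim_def downward_simulation_def by blast
next
  fix p assume "p \<in> dw_sim A"
  then obtain D where D: "downward_simulation A D" "p \<in> D"
    unfolding dw_sim_def by blast
  have *: "list_all2 (\<lambda>x y. (x, y) \<in> dw_sim A) qs rs"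
    if "list_all2 (\<lambda>x y. (x, y) \<in> D) qs rs" for qs rs
    using that by (rule list_all2_mono) (use dw_sim_upper[OF D(1)] in blast)
  show "case p of (q, r) \<Rightarrow> (q = final A \<longrightarrow> r = final A) \<and>
        (\<forall>a qs. (q, a, qs) \<in> transitions A \<longrightarrow>
           (\<exists>rs. (r, a, rs) \<in> transitions A \<and> list_all2 (\<lambda>x y. (x, y) \<in> dw_sim A) qs rs))"
  proof (cases p)
    case (Pair q r)
    have "case p of (q, r) \<Rightarrow> (q = final A \<longrightarrow> r = final A) \<and>
        (\<forall>a qs. (q, a, qs) \<in> transitions A \<longrightarrow>
           (\<exists>rs. (r, a, rs) \<in> transitions A \<and> list_all2 (\<lambda>x y. (x, y) \<in> D) qs rs))"
      using D(1) unfolding downward_simulation_def by (rule bspec[OF conjunct2 D(2)])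
    then show ?thesis
      unfolding Pair prod.case using * by blast
  qed
qed

lemma dw_sim_unique_maximal:
  "downward_simulation A D \<and> (\<forall>D'. downward_simulation A D' \<and> D \<subseteq> D' \<longrightarrow> D' = D)
     \<longleftrightarrow> D = dw_sim A"
  using dw_sim_upper downward_simulation_dw_sim by blast

lemma preorder_dw_sim:
  assumes "is_tdta A"
  shows "preorder_on (states A) (dw_sim A)"
  unfolding preorder_on_def
proof (intro conjI)
  let ?D = "dw_sim A"
  note sim = downward_simulation_dw_sim[of A, unfolded downward_simulation_def]
  show sub: "?D \<subseteq> states A \<times> states A"
    using sim by blast
  have "list_all2 (\<lambda>x y. (x, y) \<in> Id_on (states A)) qs qs" if "(q, a, qs) \<in> transitions A" for q a qs
    using that assms unfolding is_tdta_def by (intro list.rel_refl_strong) auto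
  then have "downward_simulation A (Id_on (states A))"
    unfolding downward_simulation_def by blast
  from dw_sim_upper[OF this] show "refl_on (states A) ?D"
    by (auto simp: refl_on_def)
  have comp: "list_all2 (\<lambda>x y. (x, y) \<in> ?D O ?D) qs us"
    if "list_all2 (\<lambda>x y. (x, y) \<in> ?D) qs rs" "list_all2 (\<lambda>x y. (x, y) \<in> ?D) rs us" for qs rs us
    using _ that by (rule list_all2_trans) blast
  have "downward_simulation A (?D O ?D)"
    unfolding downward_simulation_def
  proof (intro conjI ballI, goal_cases)
    case 1
    then show ?case using sub by blast
  next
    case (2 p)
    then obtain q r u where p: "p = (q, u)" and qr: "(q, r) \<in> ?D" and ru: "(r, u) \<in> ?D"
      by blast
    have "\<exists>us. (u, a, us) \<in> transitions A \<and> list_all2 (\<lambda>x y. (x, y) \<in> ?D O ?D) qs us"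
      if q: "(q, a, qs) \<in> transitions A" for a qs
    proof -
      obtain rs where rs: "(r, a, rs) \<in> transitions A" "list_all2 (\<lambda>x y. (x, y) \<in> ?D) qs rs"
        using bspec[OF conjunct2[OF sim] qr] q by auto
      obtain us where us: "(u, a, us) \<in> transitions A" "list_all2 (\<lambda>x y. (x, y) \<in> ?D) rs us"
        using bspec[OF conjunct2[OF sim] ru] rs(1) by auto
      show ?thesis using us(1) comp[OF rs(2) us(2)] by blast
    qed
    moreover have "q = final A \<longrightarrow> u = final A"
      using bspec[OF conjunct2[OF sim] qr] bspec[OF conjunct2[OF sim] ru] by simp
    ultimately show ?case using p by blast
  qed
  from dw_sim_upper[OF this] show "trans ?D"
    by (auto intro: transI)
qed

definition up_trace_incl :: "('q, 'a) tdta \<Rightarrow> 'q rel \<Rightarrow> 'q rel" where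
  "up_trace_incl A S =
     {(q, r). q \<in> states A \<and> r \<in> states A \<and>
        (q = final A \<longrightarrow> r = final A) \<and>
        (q \<in> initial A \<longrightarrow> r \<in> initial A) \<and>
        (\<forall>t \<pi>\<^sub>q v. tree_over A t \<longrightarrow> run A t \<pi>\<^sub>q \<longrightarrow> dangling_leaf t \<pi>\<^sub>q v \<longrightarrow> \<pi>\<^sub>q v = Some q \<longrightarrow>
           (\<exists>\<pi>\<^sub>r. run A t \<pi>\<^sub>r \<and> \<pi>\<^sub>r v = Some r \<and>
              (\<forall>v'. prefix v' v \<longrightarrow> the (\<pi>\<^sub>q v') \<in> initial A \<longrightarrow> the (\<pi>\<^sub>r v') \<in> initial A) \<and>
              (\<forall>v' x. strict_prefix v' v \<longrightarrow> x \<ge> 1 \<longrightarrow> v' @ [x] \<in> dom \<pi>\<^sub>q \<longrightarrow>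
                 \<not> prefix (v' @ [x]) v \<longrightarrow>
                 (the (\<pi>\<^sub>q (v' @ [x])), the (\<pi>\<^sub>r (v' @ [x]))) \<in> S)))}"

lemma preorder_up_trace_incl:
  assumes "preorder_on (states A) S"
  shows "preorder_on (states A) (up_trace_incl A S)"
  unfolding preorder_on_def
proof (intro conjI)
  have S: "refl_on (states A) S" "trans S"
    using assms unfolding preorder_on_def by auto
  show "up_trace_incl A S \<subseteq> states A \<times> states A"
    unfolding up_trace_incl_def by blast
  have "(the (\<pi> w), the (\<pi> w)) \<in> S" if "run A t \<pi>" "w \<in> dom \<pi>" for t \<pi> w
  proof -
    from that(2) obtain q where q: "\<pi> w = Some q" by blast
    then have "q \<in> states A"
      using that(1) unfolding run_def by (blast intro: ranI)
    with S(1) show ?thesis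
      unfolding refl_on_def by (simp add: q)
  qed
  then have "(q, q) \<in> up_trace_incl A S" if "q \<in> states A" for q
    using that unfolding up_trace_incl_def by blast
  then show "refl_on (states A) (up_trace_incl A S)"
    by (simp add: refl_on_def)
  show "trans (up_trace_incl A S)"
  proof (rule transI)
    fix q r s
    assume qr: "(q, r) \<in> up_trace_incl A S" and rs: "(r, s) \<in> up_trace_incl A S"
    have "\<exists>\<pi>\<^sub>s. run A t \<pi>\<^sub>s \<and> \<pi>\<^sub>s v = Some s \<and>
              (\<forall>v'. prefix v' v \<longrightarrow> the (\<pi>\<^sub>q v') \<in> initial A \<longrightarrow> the (\<pi>\<^sub>s v') \<in> initial A) \<and>
              (\<forall>v' x. strict_prefix v' v \<longrightarrow> x \<ge> 1 \<longrightarrow> v' @ [x] \<in> dom \<pi>\<^sub>q \<longrightarrow>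
                 \<not> prefix (v' @ [x]) v \<longrightarrow>
                 (the (\<pi>\<^sub>q (v' @ [x])), the (\<pi>\<^sub>s (v' @ [x]))) \<in> S)"
      if asm: "tree_over A t" "run A t \<pi>\<^sub>q" "dangling_leaf t \<pi>\<^sub>q v" "\<pi>\<^sub>q v = Some q" for t \<pi>\<^sub>q v
    proof -
      obtain \<pi>\<^sub>r where r: "run A t \<pi>\<^sub>r" "\<pi>\<^sub>r v = Some r"
        "\<forall>v'. prefix v' v \<longrightarrow> the (\<pi>\<^sub>q v') \<in> initial A \<longrightarrow> the (\<pi>\<^sub>r v') \<in> initial A"
        "\<forall>v' x. strict_prefix v' v \<longrightarrow> x \<ge> 1 \<longrightarrow> v' @ [x] \<in> dom \<pi>\<^sub>q \<longrightarrow>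
           \<not> prefix (v' @ [x]) v \<longrightarrow> (the (\<pi>\<^sub>q (v' @ [x])), the (\<pi>\<^sub>r (v' @ [x]))) \<in> S"
        using qr asm unfolding up_trace_incl_def by blast
      have dom: "dom \<pi>\<^sub>r = dom \<pi>\<^sub>q"
        using asm(2) r(1) unfolding run_def by simp
      then have "dangling_leaf t \<pi>\<^sub>r v"
        using asm(3) unfolding dangling_leaf_def by simp
      then obtain \<pi>\<^sub>s where s: "run A t \<pi>\<^sub>s" "\<pi>\<^sub>s v = Some s"
        "\<forall>v'. prefix v' v \<longrightarrow> the (\<pi>\<^sub>r v') \<in> initial A \<longrightarrow> the (\<pi>\<^sub>s v') \<in> initial A"
        "\<forall>v' x. strict_prefix v' v \<longrightarrow> x \<ge> 1 \<longrightarrow> v' @ [x] \<in> dom \<pi>\<^sub>r \<longrightarrow>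
           \<not> prefix (v' @ [x]) v \<longrightarrow> (the (\<pi>\<^sub>r (v' @ [x])), the (\<pi>\<^sub>s (v' @ [x]))) \<in> S"
        using rs asm(1) r(1,2) unfolding up_trace_incl_def by blast
      show ?thesis
      proof (intro exI[of _ \<pi>\<^sub>s] conjI allI impI)
        show "run A t \<pi>\<^sub>s" "\<pi>\<^sub>s v = Some s" by (fact s)+
        show "the (\<pi>\<^sub>s v') \<in> initial A" if "prefix v' v" "the (\<pi>\<^sub>q v') \<in> initial A" for v'
          using r(3) s(3) that by blast
        show "(the (\<pi>\<^sub>q (v' @ [x])), the (\<pi>\<^sub>s (v' @ [x]))) \<in> S"
          if "strict_prefix v' v" "1 \<le> x" "v' @ [x] \<in> dom \<pi>\<^sub>q" "\<not> prefix (v' @ [x]) v" for v' x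
          using r(4)[rule_format, OF that]
            s(4)[rule_format, OF that(1,2) _ that(4), unfolded dom, OF that(3)]
          by (rule transD[OF S(2)])
      qed
    qed
    then show "(q, s) \<in> up_trace_incl A S"
      using qr rs unfolding up_trace_incl_def by blast
  qed
qed

definition strict_part :: "'b rel \<Rightarrow> 'b rel" where
  "strict_part R = R - R\<inverse>"

text \<open>
  The lifting of the strict part of a preorder to tuples refers to the preorder itself, which its
  strict part does not determine.  Hence the preorder is the argument here and in
  \<open>pruning_relation\<close>, which renders \<open>P(R, <)\<close> for \<open><\<close> the strict part of its last argument.
\<close>

definition strict_lift :: "'b rel \<Rightarrow> 'b list rel" where
  "strict_lift le =
     {(rs, rs'). list_all2 (\<lambda>r r'. (r, r') \<in> le) rs rs' \<and>
        (\<exists>i < length rs. (rs ! i, rs' ! i) \<in> strict_part le)}"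

definition pruning_relation ::
  "('q, 'a) tdta \<Rightarrow> 'q rel \<Rightarrow> 'q rel \<Rightarrow> ('q \<times> 'a \<times> 'q list) rel" where
  "pruning_relation A R le =
     {((p, a, rs), (p', a', rs')).
        (p, a, rs) \<in> transitions A \<and> (p', a', rs') \<in> transitions A \<and> a = a' \<and>
        (p, p') \<in> R \<and> (rs, rs') \<in> strict_lift le}"

definition prune :: "('q, 'a) tdta \<Rightarrow> ('q \<times> 'a \<times> 'q list) rel \<Rightarrow> ('q, 'a) tdta" where
  "prune A P =
     A\<lparr>transitions := {\<tau> \<in> transitions A. \<not> (\<exists>\<tau>' \<in> transitions A. (\<tau>, \<tau>') \<in> P)}\<rparr>"

text \<open>
  The notion below is meant for strict partial orders \<open>P\<close> on the transitions; for
  \<open>pruning_relation\<close> and preorders this holds by \<open>strict_partial_order_pruning_relation\<close>.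
\<close>

definition good_for_pruning :: "('q, 'a) tdta \<Rightarrow> ('q \<times> 'a \<times> 'q list) rel \<Rightarrow> bool" where
  "good_for_pruning A P \<longleftrightarrow> language (prune A P) = language A"

lemma strict_partial_order_pruning_relation:
  assumes "preorder_on (states A) R" and "preorder_on (states A) le"
  shows "pruning_relation A R le \<subseteq> transitions A \<times> transitions A"
    and "irrefl (pruning_relation A R le)"
    and "trans (pruning_relation A R le)"
proof -
  show "pruning_relation A R le \<subseteq> transitions A \<times> transitions A"
    unfolding pruning_relation_def by blast
  show "irrefl (pruning_relation A R le)"
    unfolding irrefl_def pruning_relation_def strict_lift_def strict_part_def by auto
  have R: "trans R" and le: "trans le"
    using assms unfolding preorder_on_def by auto
  have "(rs, us) \<in> strict_lift le"
    if lift: "(rs, ts) \<in> strict_lift le" "(ts, us) \<in> strict_lift le" for rs ts us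
  proof -
    have 1: "list_all2 (\<lambda>r r'. (r, r') \<in> le) rs ts" "list_all2 (\<lambda>r r'. (r, r') \<in> le) ts us"
      using lift unfolding strict_lift_def by auto
    obtain i where i: "i < length rs" "(rs ! i, ts ! i) \<in> strict_part le"
      using lift(1) unfolding strict_lift_def by auto
    have "(ts ! i, us ! i) \<in> le"
      using 1 i(1) by (auto simp: list_all2_conv_all_nth)
    with i(2) have "(rs ! i, us ! i) \<in> strict_part le"
      using le unfolding strict_part_def by (blast dest: transD)
    moreover have "list_all2 (\<lambda>r r'. (r, r') \<in> le) rs us"
      using _ 1 by (rule list_all2_trans) (use le in \<open>blast dest: transD\<close>)
    ultimately show ?thesis
      using i(1) unfolding strict_lift_def by blast
  qed
  then have lift: "trans (strict_lift le)"
    by (rule transI)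
  show "trans (pruning_relation A R le)"
  proof (rule transI)
    fix x y z
    assume "(x, y) \<in> pruning_relation A R le" and "(y, z) \<in> pruning_relation A R le"
    then show "(x, z) \<in> pruning_relation A R le"
      using transD[OF R] transD[OF lift] unfolding pruning_relation_def
      by (cases x, cases y, cases z) (simp, blast)
  qed
qed

end

theory Submission imports Defs begin

text \<open>
  Weigh a run on a fixed tree by giving each state the number of states it simulates and each node
  a weight that grows so fast with the depth that deeper levels dominate lexicographically.
  Suppose that an accepting run uses at a node \<open>v\<close> a transition that is pruned in favour of
  another one.  Upward trace inclusion changes the states on the path from the root to \<open>v\<close>
  arbitrarily, but all states off this path can be chosen at least as large, and some
  child of \<open>v\<close> becomes strictly larger.  As the arbitrary changes are confined to depths up to that
  of \<open>v\<close>, the weight increases.  Hence an accepting run of maximal weight, which exists since weights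
  are bounded, only uses transitions that survive.
\<close>

section \<open>Runs as total functions with a local condition\<close>

definition run_dom :: "('q, 'a) tdta \<Rightarrow> 'a tree \<Rightarrow> node set" where
  "run_dom A t = dom t \<union> {v @ [i] | v i. v \<in> dom t \<and> 1 \<le> i \<and> i \<le> rank A (the (t v))}"

definition succ_states :: "('q, 'a) tdta \<Rightarrow> 'a tree \<Rightarrow> (node \<Rightarrow> 'q) \<Rightarrow> node \<Rightarrow> 'q list" where
  "succ_states A t f v =
     (if rank A (the (t v)) = 0 then [final A]
      else map (\<lambda>i. f (v @ [i])) [1..<rank A (the (t v)) + 1])"

text \<open>Runs are treated as total functions, so that pieces of different runs can be glued
  freely. Only the values at a node and at its children enter this condition; the restriction to
  \<open>run_dom\<close> is imposed at the very end.\<close>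

definition locally_run :: "('q, 'a) tdta \<Rightarrow> 'a tree \<Rightarrow> (node \<Rightarrow> 'q) \<Rightarrow> node \<Rightarrow> bool" where
  "locally_run A t f v \<longleftrightarrow> (f v, the (t v), succ_states A t f v) \<in> transitions A"

lemma run_iff:
  "run A t \<pi> \<longleftrightarrow>
     dom \<pi> = run_dom A t \<and> ran \<pi> \<subseteq> states A \<and> (\<forall>v \<in> dom t. locally_run A t (\<lambda>w. the (\<pi> w)) v)"
  unfolding run_def run_dom_def locally_run_def succ_states_def Let_def ..

lemma succ_states_cong:
  assumes "\<And>i. 1 \<le> i \<Longrightarrow> i \<le> rank A (the (t v)) \<Longrightarrow> f (v @ [i]) = g (v @ [i])"
  shows "succ_states A t f v = succ_states A t g v"
  using assms unfolding succ_states_def by auto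

lemma locally_run_cong:
  assumes "f v = g v"
    and "\<And>i. 1 \<le> i \<Longrightarrow> i \<le> rank A (the (t v)) \<Longrightarrow> f (v @ [i]) = g (v @ [i])"
  shows "locally_run A t f v \<longleftrightarrow> locally_run A t g v"
  using assms(1) succ_states_cong[of A t v f g, OF assms(2)] unfolding locally_run_def by simp

lemma succ_states_nth:
  assumes "1 \<le> i" "i \<le> rank A (the (t v))"
  shows "succ_states A t f v ! (i - 1) = f (v @ [i])"
  using assms unfolding succ_states_def by (auto simp del: upt_Suc)

text \<open>For rank 0 the premise on children is vacuous, and \<open>is_tdta\<close> forces
  \<open>rs = [final A]\<close>. Otherwise both lists have length the rank and are compared
  entrywise; children are numbered from 1, list positions from 0.\<close>

lemma succ_states_eqI:
  assumes A: "is_tdta A" and tr: "(q, the (t v), rs) \<in> transitions A"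
    and rs: "\<And>i. 1 \<le> i \<Longrightarrow> i \<le> rank A (the (t v)) \<Longrightarrow> f (v @ [i]) = rs ! (i - 1)"
  shows "succ_states A t f v = rs"
proof (cases "rank A (the (t v)) = 0")
  case True
  then show ?thesis
    using A tr unfolding is_tdta_def succ_states_def by auto
next
  case False
  then have "length rs = rank A (the (t v))"
    using A tr unfolding is_tdta_def by auto
  with False show ?thesis
    unfolding succ_states_def by (auto intro!: nth_equalityI simp: rs simp del: upt_Suc)
qed

section \<open>Nodes of trees and domains of runs\<close>

lemma tree_root:
  assumes "tree_over A t"
  shows "[] \<in> dom t"
proof -
  have t: "dom t \<noteq> {}" "dom t \<subseteq> lists {1..}"
    "\<And>v i. i \<ge> 1 \<Longrightarrow> v @ [i] \<in> dom t \<Longrightarrow> v \<in> dom t"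
    using assms unfolding tree_over_def is_tree_def by auto
  have "[] \<in> dom t" if "v \<in> dom t" for v
    using that
  proof (induction v rule: rev_induct)
    case (snoc i v)
    then have "i \<ge> 1" using t(2) by auto
    then show ?case using snoc t(3) by blast
  qed simp
  then show ?thesis using t(1) by blast
qed

text \<open>A node of the tree itself is the delicate case: \<open>is_tree\<close> yields the parent
  only for positive \<open>i\<close>, and positivity comes from \<open>dom t\<close> being contained
  in \<open>lists {1..}\<close>.\<close>

lemma run_dom_snoc:
  assumes "tree_over A t" "w @ [i] \<in> run_dom A t"
  shows "w \<in> dom t" "1 \<le> i" "i \<le> rank A (the (t w))"
proof -
  have t: "dom t \<subseteq> lists {1..}"
    "\<And>v i. i \<ge> 1 \<Longrightarrow> v @ [i] \<in> dom t \<Longrightarrow> v \<in> dom t \<and> i \<le> rank A (the (t v))"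
    using assms(1) unfolding tree_over_def is_tree_def by auto
  have "w \<in> dom t \<and> 1 \<le> i \<and> i \<le> rank A (the (t w))"
  proof (cases "w @ [i] \<in> dom t")
    case True
    then have "i \<ge> 1" using t(1) by auto
    then show ?thesis using True t(2) by blast
  next
    case False
    then show ?thesis using assms(2) unfolding run_dom_def by auto
  qed
  then show "w \<in> dom t" "1 \<le> i" "i \<le> rank A (the (t w))" by auto
qed

lemma tree_prefix_closed:
  assumes "tree_over A t" "w \<in> dom t" "prefix u w"
  shows "u \<in> dom t"
  using assms(2,3)
proof (induction w rule: rev_induct)
  case (snoc i w)
  then have "w \<in> dom t"
    using run_dom_snoc(1)[OF assms(1), of w i] unfolding run_dom_def by blast
  then show ?case using snoc by (auto simp: prefix_snoc)
qed simp

lemma finite_run_dom: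
  assumes "tree_over A t"
  shows "finite (run_dom A t)"
proof -
  have "run_dom A t \<subseteq> dom t \<union> (\<Union>v \<in> dom t. (\<lambda>i. v @ [i]) ` {..rank A (the (t v))})"
    unfolding run_dom_def by auto
  moreover have "finite (dom t)"
    using assms unfolding tree_over_def is_tree_def by auto
  ultimately show ?thesis
    by (auto intro: finite_subset)
qed

text \<open>The local condition alone puts all values into \<open>states A\<close>: the value at the
  root is the source of a transition, and every other value on the run domain is an entry of the
  tuple at its parent.\<close>

lemma run_of_fun:
  assumes A: "is_tdta A" and t: "tree_over A t"
    and loc: "\<And>v. v \<in> dom t \<Longrightarrow> locally_run A t f v"
  shows "run A t (\<lambda>w. if w \<in> run_dom A t then Some (f w) else None)" (is "run A t ?\<rho>")
  unfolding run_iff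
proof (intro conjI ballI)
  show "dom ?\<rho> = run_dom A t"
    by (auto split: if_splits)
  have tr: "transitions A \<subseteq> states A \<times> symbols A \<times> lists (states A)"
    using A unfolding is_tdta_def by auto
  have "f w \<in> states A" if w: "w \<in> run_dom A t" for w
  proof (cases w rule: rev_cases)
    case Nil
    then show ?thesis
      using loc[OF tree_root[OF t]] tr unfolding locally_run_def by auto
  next
    case (snoc v i)
    note i = run_dom_snoc[OF t w[unfolded snoc]]
    have "set (succ_states A t f v) \<subseteq> states A"
      using loc[OF i(1)] tr unfolding locally_run_def by auto
    then show ?thesis
      using i(2,3) unfolding succ_states_def snoc by (auto simp del: upt_Suc)
  qed
  then show "ran ?\<rho> \<subseteq> states A"
    by (auto simp: ran_def split: if_splits)
  show "locally_run A t (\<lambda>w. the (?\<rho> w)) v" if v: "v \<in> dom t" for v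
  proof -
    have "v \<in> run_dom A t" "\<And>i. 1 \<le> i \<Longrightarrow> i \<le> rank A (the (t v)) \<Longrightarrow> v @ [i] \<in> run_dom A t"
      using v unfolding run_dom_def by auto
    then show ?thesis
      using loc[OF v] locally_run_cong[of "\<lambda>w. the (?\<rho> w)" v f A t] by simp
  qed
qed

section \<open>Rebuilding a run: simulation below, upward trace inclusion above\<close>

lemma dw_sim_transition:
  assumes "(q, r) \<in> dw_sim A" "(q, a, qs) \<in> transitions A"
  shows "\<exists>rs. (r, a, rs) \<in> transitions A \<and> list_all2 (\<lambda>x y. (x, y) \<in> dw_sim A) qs rs"
proof -
  have "\<forall>(q, r) \<in> dw_sim A. (q = final A \<longrightarrow> r = final A) \<and>
        (\<forall>a qs. (q, a, qs) \<in> transitions A \<longrightarrow>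
           (\<exists>rs. (r, a, rs) \<in> transitions A \<and> list_all2 (\<lambda>x y. (x, y) \<in> dw_sim A) qs rs))"
    using downward_simulation_dw_sim[of A] unfolding downward_simulation_def by (rule conjunct2)
  from bspec[OF this assms(1)] show ?thesis
    using assms(2) by simp
qed

text \<open>\<open>\<sigma>\<close> prescribes the new run on \<open>K\<close> and on the children
  of nodes of \<open>K\<close>. Elsewhere the run is built from the top down: at a node outside
  \<open>K\<close> its state simulates that of \<open>\<pi>\<close>, so it can answer the transition
  of \<open>\<pi>\<close>, and the children are related again. \<open>side\<close> starts this
  induction at the border of \<open>K\<close>.\<close>

lemma simulating_extension:
  assumes A: "is_tdta A" and t: "tree_over A t" and \<pi>: "\<And>w. w \<in> dom t \<Longrightarrow> locally_run A t \<pi> w"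
    and K: "[] \<in> K" "\<And>w i. w @ [i] \<in> K \<Longrightarrow> w \<in> K"
    and \<sigma>: "\<And>w. w \<in> dom t \<Longrightarrow> w \<in> K \<Longrightarrow> locally_run A t \<sigma> w"
    and side: "\<And>w i. w \<in> K \<Longrightarrow> w @ [i] \<in> run_dom A t \<Longrightarrow> w @ [i] \<notin> K \<Longrightarrow>
                 (\<pi> (w @ [i]), \<sigma> (w @ [i])) \<in> dw_sim A"
  obtains \<rho> where "\<And>w. w \<in> dom t \<Longrightarrow> locally_run A t \<rho> w"
    and "\<And>w. w \<in> K \<Longrightarrow> \<rho> w = \<sigma> w" and "\<And>w i. w \<in> K \<Longrightarrow> \<rho> (w @ [i]) = \<sigma> (w @ [i])"
    and "\<And>w. w \<in> run_dom A t \<Longrightarrow> w \<notin> K \<Longrightarrow> (\<pi> w, \<rho> w) \<in> dw_sim A"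
proof -
  \<comment> \<open>The chosen tuple answers the transition of \<open>\<pi>\<close> at
    \<open>w\<close> from the state \<open>r\<close>. The choice is meaningful only for
    \<open>w\<close> in the tree and \<open>r\<close> simulating \<open>\<pi> w\<close>.\<close>
  define step where "step w r = (SOME rs. (r, the (t w), rs) \<in> transitions A \<and>
      list_all2 (\<lambda>x y. (x, y) \<in> dw_sim A) (succ_states A t \<pi> w) rs)" for w r
  \<comment> \<open>The parent of a node is obtained by dropping its last entry, so the recursion
    runs over the reversed node.\<close>
  define g where "g = rec_list (\<sigma> [])
      (\<lambda>i u r. if rev u \<in> K then \<sigma> (rev u @ [i]) else step (rev u) r ! (i - 1))"
  define \<rho> where "\<rho> w = g (rev w)" for w
  have \<rho>_Nil: "\<rho> [] = \<sigma> []"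
    and \<rho>_snoc: "\<And>w i. \<rho> (w @ [i]) = (if w \<in> K then \<sigma> (w @ [i]) else step w (\<rho> w) ! (i - 1))"
    unfolding \<rho>_def g_def by simp_all
  \<comment> \<open>A nonempty node of \<open>K\<close> has its parent in \<open>K\<close>, so its
    value comes from the \<open>\<sigma>\<close> branch.\<close>
  have \<rho>_K: "\<rho> w = \<sigma> w" if "w \<in> K" for w
    using that K(2) by (cases w rule: rev_cases) (auto simp: \<rho>_Nil \<rho>_snoc)
  have \<rho>_child: "\<rho> (w @ [i]) = \<sigma> (w @ [i])" if "w \<in> K" for w i
    using that by (simp add: \<rho>_snoc)
  have step: "(\<rho> w, the (t w), step w (\<rho> w)) \<in> transitions A"
      "list_all2 (\<lambda>x y. (x, y) \<in> dw_sim A) (succ_states A t \<pi> w) (step w (\<rho> w))"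
    if "w \<in> dom t" "(\<pi> w, \<rho> w) \<in> dw_sim A" for w
    using someI_ex[OF dw_sim_transition[OF that(2) \<pi>[OF that(1), unfolded locally_run_def]]]
    unfolding step_def by auto
  have sim: "(\<pi> w, \<rho> w) \<in> dw_sim A" if "w \<in> run_dom A t" "w \<notin> K" for w
    using that
  proof (induction w rule: rev_induct)
    case Nil
    then show ?case using K(1) by simp
  next
    case (snoc i w)
    note i = run_dom_snoc[OF t snoc.prems(1)]
    show ?case
    proof (cases "w \<in> K")
      case True
      then show ?thesis using side[OF True snoc.prems] \<rho>_child by simp
    next
      case False
      have "w \<in> run_dom A t" using i(1) unfolding run_dom_def by simp
      with False have "(\<pi> w, \<rho> w) \<in> dw_sim A" by (rule snoc.IH[rotated])
      note step(2)[OF i(1) this]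
      moreover have "i - 1 < length (succ_states A t \<pi> w)"
        using i(2,3) unfolding succ_states_def by simp
      ultimately have "(succ_states A t \<pi> w ! (i - 1), step w (\<rho> w) ! (i - 1)) \<in> dw_sim A"
        by (rule list_all2_nthD)
      then show ?thesis
        using False succ_states_nth[of i A t w, OF i(2,3)] by (simp add: \<rho>_snoc)
    qed
  qed
  have "locally_run A t \<rho> w" if w: "w \<in> dom t" for w
  proof (cases "w \<in> K")
    case True
    then show ?thesis
      using \<sigma>[OF w True] \<rho>_K \<rho>_child locally_run_cong[of \<rho> w \<sigma>] by blast
  next
    case False
    have "w \<in> run_dom A t" using w unfolding run_dom_def by simp
    note tr = step(1)[OF w sim[OF this False]]
    then have "succ_states A t \<rho> w = step w (\<rho> w)"
      by (rule succ_states_eqI[OF A]) (simp add: \<rho>_snoc False)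
    with tr show ?thesis unfolding locally_run_def by simp
  qed
  then show ?thesis using that \<rho>_K \<rho>_child sim by blast
qed

text \<open>
  The context of \<open>v\<close> is the tree without the nodes from \<open>v\<close> downwards.  For \<open>v = []\<close> it is
  empty, hence not a tree, and only the condition on initial states remains.
\<close>

lemma up_trace_incl_context:
  assumes t: "tree_over A t" and run: "run A t \<pi>" and v: "v \<in> dom t"
    and up: "(the (\<pi> v), p) \<in> up_trace_incl A S"
  obtains f where "f v = p" and "the (\<pi> []) \<in> initial A \<Longrightarrow> f [] \<in> initial A"
    and "\<And>w. strict_prefix w v \<Longrightarrow> locally_run A t f w"
    and "\<And>w i. strict_prefix w v \<Longrightarrow> w @ [i] \<in> run_dom A t \<Longrightarrow> \<not> prefix (w @ [i]) v \<Longrightarrow>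
           (the (\<pi> (w @ [i])), f (w @ [i])) \<in> S"
proof (cases "v = []")
  case True
  then have "the (\<pi> []) \<in> initial A \<Longrightarrow> p \<in> initial A"
    using up unfolding up_trace_incl_def by auto
  then show ?thesis
    using True by (intro that[of "\<lambda>_. p"]) auto
next
  case False
  define s where "s = t |` {w. \<not> prefix v w}"
  \<comment> \<open>Unlike in \<open>s\<close>, the node \<open>v\<close> is kept, which turns it
    into a dangling leaf of \<open>\<mu>\<close>.\<close>
  define \<mu> where "\<mu> = \<pi> |` {w. prefix v w \<longrightarrow> w = v}"
  have dom_s: "dom s = {w \<in> dom t. \<not> prefix v w}"
    and s: "\<And>w. \<not> prefix v w \<Longrightarrow> s w = t w"
    unfolding s_def by auto
  have ran_s: "ran s \<subseteq> ran t"
    unfolding s_def by (auto simp: ran_def restrict_map_def split: if_splits)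
  have dom_\<pi>: "dom \<pi> = run_dom A t" and ran_\<pi>: "ran \<pi> \<subseteq> states A"
    and loc: "\<And>w. w \<in> dom t \<Longrightarrow> locally_run A t (\<lambda>w. the (\<pi> w)) w"
    using run unfolding run_iff by auto
  have "[] \<in> dom s"
    using False tree_root[OF t] by (simp add: dom_s)
  moreover have "finite (dom s)" "dom s \<subseteq> lists {1..}" "ran s \<subseteq> symbols A"
    using t ran_s unfolding tree_over_def is_tree_def dom_s by auto
  moreover have "w \<in> dom s \<and> i \<le> rank A (the (s w))"
    if "i \<ge> 1" "w @ [i] \<in> dom s" for w i
  proof -
    have "w @ [i] \<in> dom t" "\<not> prefix v (w @ [i])" using that(2) by (auto simp: dom_s)
    then have "\<not> prefix v w" "w \<in> dom t" "i \<le> rank A (the (t w))"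
      using run_dom_snoc[OF t, of w i] by (auto simp: run_dom_def prefix_snoc)
    then show ?thesis using s by (simp add: dom_s)
  qed
  ultimately have tree_s: "tree_over A s"
    unfolding tree_over_def is_tree_def by blast
  have run_dom_s: "run_dom A s = {w \<in> run_dom A t. prefix v w \<longrightarrow> w = v}"
  proof (intro set_eqI)
    fix w
    show "w \<in> run_dom A s \<longleftrightarrow> w \<in> {w \<in> run_dom A t. prefix v w \<longrightarrow> w = v}"
    proof (cases w rule: rev_cases)
      case Nil
      then show ?thesis
        using False tree_root[OF t] by (auto simp: run_dom_def dom_s)
    next
      case (snoc u i)
      have "w \<in> run_dom A s \<longleftrightarrow> u \<in> dom s \<and> 1 \<le> i \<and> i \<le> rank A (the (s u))"
        using run_dom_snoc[OF tree_s, of u i] unfolding snoc run_dom_def by blast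
      also have "\<dots> \<longleftrightarrow> u \<in> dom t \<and> \<not> prefix v u \<and> 1 \<le> i \<and> i \<le> rank A (the (t u))"
        using s by (auto simp: dom_s)
      also have "\<dots> \<longleftrightarrow> w \<in> run_dom A t \<and> \<not> prefix v u"
        using run_dom_snoc[OF t, of u i] unfolding snoc run_dom_def by blast
      \<comment> \<open>A word \<open>u @ [i]\<close> extends \<open>v\<close> exactly if
        \<open>u\<close> does or the word equals \<open>v\<close>; the second case is the one that
        stays in the run domain.\<close>
      also have "\<not> prefix v u \<longleftrightarrow> (prefix v w \<longrightarrow> w = v)"
        unfolding snoc prefix_snoc by (auto simp: prefix_def)
      finally show ?thesis by simp
    qed
  qed
  have \<mu>: "\<mu> w = \<pi> w" if "w \<in> run_dom A s" for w
    using that unfolding \<mu>_def run_dom_s by simp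
  have dom_\<mu>: "dom \<mu> = run_dom A s"
    unfolding \<mu>_def run_dom_s using dom_\<pi> by auto
  have run_\<mu>: "run A s \<mu>"
    unfolding run_iff
  proof (intro conjI ballI)
    show "dom \<mu> = run_dom A s" by (fact dom_\<mu>)
    show "ran \<mu> \<subseteq> states A"
      using ran_\<pi> unfolding \<mu>_def by (auto simp: ran_def restrict_map_def split: if_splits)
    fix w assume w: "w \<in> dom s"
    then have sw: "s w = t w" "w \<in> dom t"
      using s by (auto simp: dom_s)
    have "w \<in> run_dom A s"
      "\<And>i. 1 \<le> i \<Longrightarrow> i \<le> rank A (the (s w)) \<Longrightarrow> w @ [i] \<in> run_dom A s"
      using w unfolding run_dom_def by auto
    then have "locally_run A s (\<lambda>w. the (\<mu> w)) w \<longleftrightarrow> locally_run A s (\<lambda>w. the (\<pi> w)) w"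
      by (intro locally_run_cong) (simp_all add: \<mu>)
    \<comment> \<open>The local condition consults the tree only at \<open>w\<close>, where
      \<open>s\<close> and \<open>t\<close> agree; a child that was cut off does not matter.\<close>
    also have "\<dots> \<longleftrightarrow> locally_run A t (\<lambda>w. the (\<pi> w)) w"
      unfolding locally_run_def succ_states_def sw(1) ..
    finally show "locally_run A s (\<lambda>w. the (\<mu> w)) w"
      using loc[OF sw(2)] by simp
  qed
  have "v \<in> run_dom A t"
    using v unfolding run_dom_def by simp
  then have v_s: "v \<in> run_dom A s" and v_\<pi>: "v \<in> dom \<pi>"
    unfolding run_dom_s dom_\<pi> by simp_all
  have "dangling_leaf s \<mu> v"
    using v_s unfolding dangling_leaf_def dom_\<mu> by (simp add: dom_s)
  moreover have "\<mu> v = Some (the (\<pi> v))"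
    using v_\<pi> \<mu>[OF v_s] by auto
  ultimately obtain \<nu> where \<nu>: "run A s \<nu>" "\<nu> v = Some p"
    "\<forall>v'. prefix v' v \<longrightarrow> the (\<mu> v') \<in> initial A \<longrightarrow> the (\<nu> v') \<in> initial A"
    "\<forall>v' x. strict_prefix v' v \<longrightarrow> x \<ge> 1 \<longrightarrow> v' @ [x] \<in> dom \<mu> \<longrightarrow>
       \<not> prefix (v' @ [x]) v \<longrightarrow> (the (\<mu> (v' @ [x])), the (\<nu> (v' @ [x]))) \<in> S"
    using up tree_s run_\<mu> unfolding up_trace_incl_def by blast
  show ?thesis
  proof (rule that[of "\<lambda>w. the (\<nu> w)"])
    show "the (\<nu> v) = p" using \<nu>(2) by simp
    have "[] \<in> run_dom A s"
      using \<open>[] \<in> dom s\<close> unfolding run_dom_def by simp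
    then show "the (\<nu> []) \<in> initial A" if "the (\<pi> []) \<in> initial A"
      using \<nu>(3) that \<mu> by simp
    show "locally_run A t (\<lambda>w. the (\<nu> w)) w" if w: "strict_prefix w v" for w
    proof -
      have nw: "\<not> prefix v w"
        using w by (auto simp: strict_prefix_def dest: prefix_order.antisym)
      moreover have "w \<in> dom t"
        using tree_prefix_closed[OF t v] w by (simp add: strict_prefix_def)
      ultimately have "locally_run A s (\<lambda>w. the (\<nu> w)) w"
        using \<nu>(1) unfolding run_iff dom_s by blast
      then show ?thesis
        unfolding locally_run_def succ_states_def s[OF nw] .
    qed
    show "(the (\<pi> (w @ [i])), the (\<nu> (w @ [i]))) \<in> S"
      if w: "strict_prefix w v" "w @ [i] \<in> run_dom A t" "\<not> prefix (w @ [i]) v" for w i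
    proof -
      \<comment> \<open>Since \<open>w\<close> is strictly above \<open>v\<close>, the word
        \<open>w @ [i]\<close> could extend \<open>v\<close> only by being equal to it, and then it
        would be a prefix of \<open>v\<close>.\<close>
      have "\<not> prefix v (w @ [i])"
        using w(1,3) by (auto simp: prefix_snoc strict_prefix_def dest: prefix_order.antisym)
      then have wi: "w @ [i] \<in> run_dom A s"
        using w(2) unfolding run_dom_s by simp
      then show ?thesis
        using \<nu>(4) w(1,3) run_dom_snoc(2)[OF t w(2)] \<mu>[OF wi] unfolding dom_\<mu> by metis
    qed
  qed
qed

section \<open>Weights of runs\<close>

text \<open>On the left, all terms of depth at most \<open>k\<close> add up to at most
  \<open>card X * H * B ^ k\<close>, which is less than \<open>B ^ Suc k\<close>. Even if all of
  them are lost, the gain of one unit at \<open>w0\<close>, worth \<open>B ^ length w0\<close>,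
  outweighs them.\<close>

lemma depth_weighted_sum_less:
  fixes g g' :: "'b list \<Rightarrow> nat"
  assumes X: "finite X" and H: "\<And>w. w \<in> X \<Longrightarrow> g w \<le> H" and B: "card X * H < B"
    and le: "\<And>w. w \<in> X \<Longrightarrow> k < length w \<Longrightarrow> g w \<le> g' w"
    and w0: "w0 \<in> X" "k < length w0" "g w0 < g' w0"
  shows "(\<Sum>w\<in>X. g w * B ^ length w) < (\<Sum>w\<in>X. g' w * B ^ length w)"
proof -
  let ?lo = "{w \<in> X. length w \<le> k}" and ?hi = "{w \<in> X. k < length w}"
  have split: "(\<Sum>w\<in>X. h w) = (\<Sum>w\<in>?lo. h w) + (\<Sum>w\<in>?hi. h w)" for h :: "'b list \<Rightarrow> nat"
  proof -
    have "X = ?lo \<union> ?hi" "?lo \<inter> ?hi = {}" by auto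
    then show ?thesis using X by (metis (no_types, lifting) finite_Un sum.union_disjoint)
  qed
  have "B \<ge> 1" using B by simp
  have "(\<Sum>w\<in>?lo. g w * B ^ length w) \<le> (\<Sum>w\<in>?lo. H * B ^ k)"
    using H \<open>B \<ge> 1\<close> by (intro sum_mono mult_le_mono power_increasing) auto
  also have "\<dots> \<le> card X * (H * B ^ k)"
    using X by (simp add: card_mono)
  also have "\<dots> < B * B ^ k"
    using B \<open>B \<ge> 1\<close> by (metis mult.assoc mult_less_cancel2 zero_less_one order_less_le_trans zero_less_power)
  also have "\<dots> \<le> B ^ length w0"
    using w0(2) \<open>B \<ge> 1\<close> power_increasing[of "Suc k" "length w0" B] by simp
  finally have lo: "(\<Sum>w\<in>?lo. g w * B ^ length w) < B ^ length w0" .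
  have w0': "w0 \<in> ?hi" and fin: "finite ?hi" using w0 X by auto
  \<comment> \<open>The additional \<open>B ^ length w0\<close> raises the coefficient at
    \<open>w0\<close> by one, and \<open>g' w0\<close> still covers it.\<close>
  have "(\<Sum>w\<in>?hi. g w * B ^ length w) + B ^ length w0
      = (g w0 + 1) * B ^ length w0 + (\<Sum>w\<in>?hi - {w0}. g w * B ^ length w)"
    using sum.remove[OF fin w0', of "\<lambda>w. g w * B ^ length w"] by (simp add: algebra_simps)
  also have "\<dots> \<le> g' w0 * B ^ length w0 + (\<Sum>w\<in>?hi - {w0}. g' w * B ^ length w)"
    using w0 le by (intro add_mono mult_le_mono sum_mono) auto
  also have "\<dots> = (\<Sum>w\<in>?hi. g' w * B ^ length w)"
    using sum.remove[OF fin w0', of "\<lambda>w. g' w * B ^ length w"] by simp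
  finally show ?thesis
    using lo split[of "\<lambda>w. g w * B ^ length w"] split[of "\<lambda>w. g' w * B ^ length w"] by linarith
qed

lemma card_below_mono:
  assumes "finite X" "le \<subseteq> X \<times> X" "trans le" "(q, r) \<in> le"
  shows "card {p. (p, q) \<in> le} \<le> card {p. (p, r) \<in> le}"
proof (rule card_mono)
  show "finite {p. (p, r) \<in> le}" by (rule finite_subset[OF _ assms(1)]) (use assms(2) in auto)
  show "{p. (p, q) \<in> le} \<subseteq> {p. (p, r) \<in> le}" using assms(3,4) by (auto dest: transD)
qed

text \<open>The state \<open>r\<close> lies below itself but not below \<open>q\<close>, so the
  inclusion of the two sets is proper.\<close>

lemma card_below_strict_mono:
  assumes "finite X" "preorder_on X le" "(q, r) \<in> strict_part le"
  shows "card {p. (p, q) \<in> le} < card {p. (p, r) \<in> le}"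
proof (rule psubset_card_mono)
  have le: "le \<subseteq> X \<times> X" "refl_on X le" "trans le"
    using assms(2) unfolding preorder_on_def by auto
  have qr: "(q, r) \<in> le" "(r, q) \<notin> le"
    using assms(3) unfolding strict_part_def by auto
  show "finite {p. (p, r) \<in> le}" by (rule finite_subset[OF _ assms(1)]) (use le(1) in auto)
  have "(r, r) \<in> le" using qr(1) le by (auto simp: refl_on_def)
  then show "{p. (p, q) \<in> le} \<subset> {p. (p, r) \<in> le}"
    using qr le(3) by (auto dest: transD)
qed

section \<open>Improving a run at a pruned transition\<close>

text \<open>The new run follows \<open>up_trace_incl_context\<close> on the path to \<open>v\<close>
  and beside it, takes the preferred transition at \<open>v\<close>, and is completed by
  \<open>simulating_extension\<close> with \<open>K\<close> the set of prefixes of \<open>v\<close>.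
  As that lemma keeps the prescribed values on children of nodes of \<open>K\<close>, the strict
  gain at a child of \<open>v\<close> survives.\<close>

lemma run_improvement:
  assumes A: "is_tdta A" and t: "tree_over A t" and run: "run A t \<pi>"
    and v: "v \<in> dom t" and init: "the (\<pi> []) \<in> initial A"
    and pruned: "((the (\<pi> v), the (t v), succ_states A t (\<lambda>w. the (\<pi> w)) v), \<tau>)
      \<in> pruning_relation A (up_trace_incl A (dw_sim A)) (dw_sim A)"
  obtains \<rho> where "run A t \<rho>" and "the (\<rho> []) \<in> initial A"
    and "\<And>w. w \<in> run_dom A t \<Longrightarrow> length v < length w \<Longrightarrow> (the (\<pi> w), the (\<rho> w)) \<in> dw_sim A"
    and "\<exists>w \<in> run_dom A t. length v < length w \<and>
           (the (\<pi> w), the (\<rho> w)) \<in> strict_part (dw_sim A)"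
proof -
  let ?\<pi> = "\<lambda>w. the (\<pi> w)" and ?a = "the (t v)"
  obtain p rs where tr: "(p, ?a, rs) \<in> transitions A" and up: "(?\<pi> v, p) \<in> up_trace_incl A (dw_sim A)"
    and lift: "(succ_states A t ?\<pi> v, rs) \<in> strict_lift (dw_sim A)"
    using pruned unfolding pruning_relation_def by auto
  from lift have all: "list_all2 (\<lambda>q r. (q, r) \<in> dw_sim A) (succ_states A t ?\<pi> v) rs"
    unfolding strict_lift_def by simp
  from lift obtain j where j: "j < length (succ_states A t ?\<pi> v)"
    "(succ_states A t ?\<pi> v ! j, rs ! j) \<in> strict_part (dw_sim A)"
    unfolding strict_lift_def by auto
  \<comment> \<open>At rank 0 both tuples would be \<open>[final A]\<close>, leaving no room for a
    strict increase.\<close>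
  have rank: "rank A ?a \<noteq> 0"
  proof
    assume r0: "rank A ?a = 0"
    then have "rs = [final A]" using A tr unfolding is_tdta_def by auto
    with r0 j show False unfolding succ_states_def strict_part_def by auto
  qed
  have loc: "\<And>w. w \<in> dom t \<Longrightarrow> locally_run A t ?\<pi> w"
    using run unfolding run_iff by simp
  obtain f where f: "f v = p" "?\<pi> [] \<in> initial A \<Longrightarrow> f [] \<in> initial A"
    "\<And>w. strict_prefix w v \<Longrightarrow> locally_run A t f w"
    "\<And>w i. strict_prefix w v \<Longrightarrow> w @ [i] \<in> run_dom A t \<Longrightarrow> \<not> prefix (w @ [i]) v \<Longrightarrow>
       (?\<pi> (w @ [i]), f (w @ [i])) \<in> dw_sim A"
    using up_trace_incl_context[OF t run v up] by blast
  \<comment> \<open>Below \<open>v\<close> only the children of \<open>v\<close> matter: there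
    \<open>last w\<close> is the child number, shifted by one to a position in \<open>rs\<close>.
    Values deeper down are never consulted.\<close>
  define \<sigma> where "\<sigma> w = (if strict_prefix v w then rs ! (last w - 1) else f w)" for w
  have \<sigma>_prefix: "\<sigma> w = f w" if "prefix w v" for w
    using that unfolding \<sigma>_def by (auto dest: prefix_order.leD)
  have \<sigma>_side: "\<sigma> (w @ [i]) = f (w @ [i])" if "strict_prefix w v" for w i
  proof -
    \<comment> \<open>A child of a strict prefix of \<open>v\<close> is no longer than
      \<open>v\<close>.\<close>
    have "\<not> strict_prefix v (w @ [i])"
      using prefix_length_less[OF that] prefix_length_less[of v "w @ [i]"] by auto
    then show ?thesis unfolding \<sigma>_def by simp
  qed
  have \<sigma>_child: "\<sigma> (v @ [i]) = rs ! (i - 1)" for i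
    unfolding \<sigma>_def by (simp add: strict_prefix_def)
  obtain \<rho> where \<rho>: "\<And>w. w \<in> dom t \<Longrightarrow> locally_run A t \<rho> w"
    "\<And>w. prefix w v \<Longrightarrow> \<rho> w = \<sigma> w" "\<And>w i. prefix w v \<Longrightarrow> \<rho> (w @ [i]) = \<sigma> (w @ [i])"
    "\<And>w. w \<in> run_dom A t \<Longrightarrow> \<not> prefix w v \<Longrightarrow> (?\<pi> w, \<rho> w) \<in> dw_sim A"
  proof (rule simulating_extension[OF A t loc, of "{w. prefix w v}" \<sigma>], unfold mem_Collect_eq)
    show "prefix [] v" by simp
    show "prefix w v" if "prefix (w @ [i]) v" for w i
      using that by (rule append_prefixD)
    show "locally_run A t \<sigma> w" if "w \<in> dom t" "prefix w v" for w
    proof (cases "w = v")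
      case True
      have "succ_states A t \<sigma> v = rs"
        by (rule succ_states_eqI[of A p t v rs, OF A tr]) (simp add: \<sigma>_child)
      then show ?thesis
        using tr unfolding True locally_run_def by (simp add: \<sigma>_prefix f(1))
    next
      case False
      with that(2) have w: "strict_prefix w v" by (simp add: strict_prefix_def)
      then show ?thesis
        using f(3)[OF w] locally_run_cong[of \<sigma> w f A t] \<sigma>_prefix[OF that(2)] \<sigma>_side[OF w] by simp
    qed
    show "(?\<pi> (w @ [i]), \<sigma> (w @ [i])) \<in> dw_sim A"
      if "prefix w v" "w @ [i] \<in> run_dom A t" "\<not> prefix (w @ [i]) v" for w i
    proof (cases "w = v")
      case True
      have i: "1 \<le> i" "i \<le> rank A ?a"
        using run_dom_snoc[OF t that(2)] True by auto
      then have "i - 1 < length (succ_states A t ?\<pi> v)"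
        unfolding succ_states_def by simp
      from list_all2_nthD[OF all this] show ?thesis
        unfolding True \<sigma>_child succ_states_nth[of i A t v, OF i] .
    next
      case False
      with that(1) have w: "strict_prefix w v" by (simp add: strict_prefix_def)
      show ?thesis
        using f(4)[OF w that(2,3)] \<sigma>_side[OF w] by simp
    qed
  qed (assumption, blast)
  define R where "R w = (if w \<in> run_dom A t then Some (\<rho> w) else None)" for w
  have "run A t R"
    unfolding R_def[abs_def] using A t \<rho>(1) by (rule run_of_fun)
  moreover have "the (R []) \<in> initial A"
    using f(2)[OF init] tree_root[OF t] \<rho>(2)[of "[]"] \<sigma>_prefix[of "[]"]
    unfolding R_def run_dom_def by simp
  \<comment> \<open>A node longer than \<open>v\<close> is not a prefix of \<open>v\<close>, hence
    lies outside \<open>K\<close>.\<close>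
  moreover have "(?\<pi> w, the (R w)) \<in> dw_sim A" if "w \<in> run_dom A t" "length v < length w" for w
    using \<rho>(4)[OF that(1)] that prefix_length_le[of w v] unfolding R_def by auto
  moreover have "\<exists>w \<in> run_dom A t. length v < length w \<and>
      (?\<pi> w, the (R w)) \<in> strict_part (dw_sim A)"
  proof (intro bexI conjI)
    \<comment> \<open>Position \<open>j\<close> of the tuple belongs to the child numbered
      \<open>Suc j\<close>.\<close>
    have j': "1 \<le> Suc j" "Suc j \<le> rank A ?a"
      using j(1) rank unfolding succ_states_def by auto
    then show w: "v @ [Suc j] \<in> run_dom A t"
      using v unfolding run_dom_def by auto
    show "(?\<pi> (v @ [Suc j]), the (R (v @ [Suc j]))) \<in> strict_part (dw_sim A)"
      using j(2) w succ_states_nth[of "Suc j" A t v ?\<pi>, OF j'] \<rho>(3)[of v "Suc j"] \<sigma>_child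
      unfolding R_def by simp
  qed simp
  ultimately show ?thesis by (rule that)
qed

section \<open>Pruning and runs of maximal weight\<close>

lemma prune_simps [simp]:
  "symbols (prune A P) = symbols A" "rank (prune A P) = rank A" "states (prune A P) = states A"
  "initial (prune A P) = initial A" "final (prune A P) = final A"
  unfolding prune_def by simp_all

text \<open>Pruning alters only \<open>transitions\<close>, whereas \<open>run_dom\<close> and
  \<open>succ_states\<close> depend on the automaton only through ranks and the final state.\<close>

lemma run_prune_iff:
  "run (prune A P) t \<pi> \<longleftrightarrow> run A t \<pi> \<and>
     (\<forall>v \<in> dom t. \<not> (\<exists>\<tau> \<in> transitions A.
        ((the (\<pi> v), the (t v), succ_states A t (\<lambda>w. the (\<pi> w)) v), \<tau>) \<in> P))"
proof -
  have "run_dom (prune A P) t = run_dom A t" "succ_states (prune A P) t = succ_states A t"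
    unfolding run_dom_def succ_states_def[abs_def] by (simp_all cong: if_cong)
  then show ?thesis
    unfolding run_iff locally_run_def by (auto simp: prune_def)
qed

lemma accepting_run_prune:
  fixes A :: "('q, 'a) tdta"
  assumes A: "is_tdta A" and t: "tree_over A t"
    and acc: "run A t \<pi>" "the (\<pi> []) \<in> initial A"
  shows "\<exists>\<rho>. run (prune A (pruning_relation A (up_trace_incl A (dw_sim A)) (dw_sim A))) t \<rho>
           \<and> the (\<rho> []) \<in> initial A"
proof -
  let ?h = "\<lambda>q. card {p. (p, q) \<in> dw_sim A}"
  define X where "X = run_dom A t"
  define H where "H = card (states A)"
  \<comment> \<open>The base exceeds the sum of all unscaled state values, so one unit at a deeper
    level beats everything above it.\<close>
  define B where "B = Suc (card X * H)"
  define weight where "weight \<rho> = (\<Sum>w\<in>X. ?h (the (\<rho> w)) * B ^ length w)" for \<rho> :: "node \<rightharpoonup> 'q"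
  define acc_run where "acc_run \<rho> \<longleftrightarrow> run A t \<rho> \<and> the (\<rho> []) \<in> initial A" for \<rho>
  have fin: "finite (states A)" using A unfolding is_tdta_def by simp
  have pre: "preorder_on (states A) (dw_sim A)" using A by (rule preorder_dw_sim)
  then have D: "dw_sim A \<subseteq> states A \<times> states A" "trans (dw_sim A)"
    unfolding preorder_on_def by auto
  have h: "?h q \<le> H" for q
    unfolding H_def by (rule card_mono[OF fin]) (use D(1) in auto)
  have "weight \<rho> \<le> (\<Sum>w\<in>X. H * B ^ length w)" for \<rho>
    unfolding weight_def by (intro sum_mono mult_right_mono h) simp
  then have "\<forall>\<rho>. acc_run \<rho> \<longrightarrow> weight \<rho> < Suc (\<Sum>w\<in>X. H * B ^ length w)"
    by (simp add: le_imp_less_Suc)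
  moreover have "acc_run \<pi>" using acc unfolding acc_run_def by simp
  \<comment> \<open>A maximum exists because weights are natural numbers with a common upper bound;
    the set of runs need not be shown finite.\<close>
  ultimately obtain \<mu> where \<mu>: "acc_run \<mu>" and max: "\<And>\<rho>. acc_run \<rho> \<Longrightarrow> weight \<rho> \<le> weight \<mu>"
    using ex_has_greatest_nat[of acc_run \<pi> weight] by (meson less_or_eq_imp_le)
  have False
    if v: "v \<in> dom t" and pruned: "((the (\<mu> v), the (t v), succ_states A t (\<lambda>w. the (\<mu> w)) v), \<tau>)
        \<in> pruning_relation A (up_trace_incl A (dw_sim A)) (dw_sim A)" for v \<tau>
  proof -
    obtain \<rho> where \<rho>: "run A t \<rho>" "the (\<rho> []) \<in> initial A"
      "\<And>w. w \<in> X \<Longrightarrow> length v < length w \<Longrightarrow> (the (\<mu> w), the (\<rho> w)) \<in> dw_sim A"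
      "\<exists>w \<in> X. length v < length w \<and> (the (\<mu> w), the (\<rho> w)) \<in> strict_part (dw_sim A)"
      using run_improvement[OF A t _ v _ pruned] \<mu> unfolding acc_run_def X_def by blast
    from \<rho>(4) obtain w0 where w0: "w0 \<in> X" "length v < length w0"
      "(the (\<mu> w0), the (\<rho> w0)) \<in> strict_part (dw_sim A)" by blast
    have "weight \<mu> < weight \<rho>"
      unfolding weight_def
    proof (rule depth_weighted_sum_less[OF _ h _ _ w0(1,2)])
      show "finite X" unfolding X_def using t by (rule finite_run_dom)
      show "card X * H < B" unfolding B_def by simp
      show "?h (the (\<mu> w)) \<le> ?h (the (\<rho> w))" if "w \<in> X" "length v < length w" for w
        using card_below_mono[OF fin D \<rho>(3)[OF that]] .
      show "?h (the (\<mu> w0)) < ?h (the (\<rho> w0))"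
        using card_below_strict_mono[OF fin pre w0(3)] .
    qed
    moreover have "weight \<rho> \<le> weight \<mu>"
      using max \<rho>(1,2) unfolding acc_run_def by blast
    ultimately show False by simp
  qed
  then show ?thesis
    using \<mu> unfolding acc_run_def run_prune_iff by blast
qed

theorem theorem4:
  fixes A :: "('q, 'a) tdta"
  assumes "is_tdta A"
  shows "good_for_pruning A (pruning_relation A (up_trace_incl A (dw_sim A)) (dw_sim A))"
  unfolding good_for_pruning_def
proof (intro equalityI subsetI)
  fix t
  assume "t \<in> language (prune A (pruning_relation A (up_trace_incl A (dw_sim A)) (dw_sim A)))"
  then show "t \<in> language A"
    unfolding language_def tree_over_def by (auto simp: run_prune_iff)
next
  fix t
  assume "t \<in> language A"
  then show "t \<in> language (prune A (pruning_relation A (up_trace_incl A (dw_sim A)) (dw_sim A)))"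
    \<comment> \<open>Being a closed tree depends only on symbols and ranks, which pruning
      keeps.\<close>
    using accepting_run_prune[OF assms, of t]
    unfolding language_def tree_over_def by auto
qed

end
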